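(* Let $A\in\mathbb{R}^{n\times n}$ and $b\in\mathbb{R}^n$ satisfy $\operatorname{sym}(A)\succeq I$, and suppose the solution set $S=\{x\in\mathbb{R}^n:\Phi(x)=0\}$ of $\Phi(x):=Ax-|x|-b=0$ is nonempty. Let $0<\rho<1$, $\epsilon>0$, and $x^0\in\mathbb{R}^n$. Then the CPPC method described in the context is well defined (i.e. $v^k\ne0$ at every nonterminal iteration $k$), and it either terminates at a point in $S$ or generates an infinite sequence $(x^k)$ converging to a point in $S$. In the latter case, $$\sum_{k=0}^{\infty}\|R(x^k)\|_\infty^2<\infty,\qquad R(x^k)\to0,\qquad \Phi(x^k)\to0.$$
   Context: $|x|$ is the componentwise absolute value; $\langle\cdot,\cdot\rangle$, $\|\cdot\|$ are the Euclidean inner product and norm; $\|\cdot\|_\infty$ is the maximum norm; $\operatorname{sym}(A)=(A+A^\top)/2$; $I$ is the identity; $M\succeq N$ means $M-N$ is positive semidefinite. For $t\in\mathbb{R}$ put $t^-=\max\{-t,0\}$ and $g(t)=(t^-)^2$. Let $F(x)=(A-I)x-b$. Given $0<\rho<1$ and $\epsilon>0$, set $\ell_i=\max\{a_{ii}-1,\epsilon\}$ and $\gamma_i=\rho/\ell_i$ for $i=1,\dots,n$. For $\gamma>0$ and $z\in\mathbb{R}$, $\operatorname{prox}_{\gamma g}(z)=\arg\min_{t\in\mathbb{R}}\{g(t)+(2\gamma)^{-1}|t-z|^2\}$; explicitly, $\operatorname{prox}_{\gamma g}(z)=z$ if $z\ge0$ and $z/(1+2\gamma)$ if $z<0$. The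 coordinate proximal residual is $R(x)=(R_i(x))_{i=1}^n$ with $R_i(x)=\gamma_i^{-1}\bigl[x_i-\operatorname{prox}_{\gamma_i g}(x_i-\gamma_iF_i(x))\bigr]$. CPPC method: from an arbitrary $x^0\in\mathbb{R}^n$, for $k=0,1,2,\dots$: choose any $i_k\in\arg\max_{1\le i\le n}|R_i(x^k)|$. If $R_{i_k}(x^k)=0$, terminate and return $x^k$. Otherwise (a nonterminal iteration) define $y^k$ by $y^k_j=x^k_j$ for $j\ne i_k$ and $y^k_{i_k}=\operatorname{prox}_{\gamma_{i_k}g}(x^k_{i_k}-\gamma_{i_k}F_{i_k}(x^k))$; set $d^k=x^k-y^k$, $v^k=\Phi(y^k)$, $\lambda_k=\langle v^k,d^k\rangle/\|v^k\|^2$, and $x^{k+1}=x^k-\lambda_kv^k$. *)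

theory Defs
  imports "HOL-Analysis.Analysis" "HOL-Library.Extended_Nat"
begin

definition sym_part :: "real^'n^'n \<Rightarrow> real^'n^'n"
  where "sym_part A = (1/2) *\<^sub>R (A + transpose A)"

definition psd :: "real^'n^'n \<Rightarrow> bool"
  where "psd M \<longleftrightarrow> transpose M = M \<and> (\<forall>x. 0 \<le> x \<bullet> (M *v x))"

definition loewner_ge :: "real^'n^'n \<Rightarrow> real^'n^'n \<Rightarrow> bool"  (infix "\<succeq>" 50)
  where "M \<succeq> N \<longleftrightarrow> psd (M - N)"

definition abs_vec :: "real^'n \<Rightarrow> real^'n"
  where "abs_vec x = (\<chi> i. \<bar>x $ i\<bar>)"

definition \<Phi> :: "real^'n^'n \<Rightarrow> real^'n \<Rightarrow> real^'n \<Rightarrow> real^'n"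
  where "\<Phi> A b x = A *v x - abs_vec x - b"

definition solutions :: "real^'n^'n \<Rightarrow> real^'n \<Rightarrow> (real^'n) set"
  where "solutions A b = {x. \<Phi> A b x = 0}"

definition F :: "real^'n^'n \<Rightarrow> real^'n \<Rightarrow> real^'n \<Rightarrow> real^'n"
  where "F A b x = (A - mat 1) *v x - b"

definition neg_part :: "real \<Rightarrow> real"
  where "neg_part t = max (- t) 0"

definition g :: "real \<Rightarrow> real"
  where "g t = (neg_part t)\<^sup>2"

text \<open>The minimizer is unique for \<open>\<gamma> > 0\<close> (lemma \<open>prox_g\<close> below for \<open>f = g\<close>), so the choice made
  by \<open>ARG_MIN\<close> is immaterial.\<close>

definition prox :: "real \<Rightarrow> (real \<Rightarrow> real) \<Rightarrow> real \<Rightarrow> real"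
  where "prox \<gamma> f z = (ARG_MIN (\<lambda>t. f t + inverse (2 * \<gamma>) * \<bar>t - z\<bar>\<^sup>2) t. True)"

definition ell :: "real^'n^'n \<Rightarrow> real \<Rightarrow> 'n \<Rightarrow> real"
  where "ell A \<epsilon> i = max (A $ i $ i - 1) \<epsilon>"

definition stepsize :: "real^'n^'n \<Rightarrow> real \<Rightarrow> real \<Rightarrow> 'n \<Rightarrow> real"
  where "stepsize A \<rho> \<epsilon> i = \<rho> / ell A \<epsilon> i"

definition prox_coord :: "real^'n^'n \<Rightarrow> real^'n \<Rightarrow> real \<Rightarrow> real \<Rightarrow> 'n \<Rightarrow> real^'n \<Rightarrow> real"
  where "prox_coord A b \<rho> \<epsilon> i x =
    prox (stepsize A \<rho> \<epsilon> i) g (x $ i - stepsize A \<rho> \<epsilon> i * F A b x $ i)"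

definition R :: "real^'n^'n \<Rightarrow> real^'n \<Rightarrow> real \<Rightarrow> real \<Rightarrow> real^'n \<Rightarrow> real^'n"
  where "R A b \<rho> \<epsilon> x =
    (\<chi> i. inverse (stepsize A \<rho> \<epsilon> i) * (x $ i - prox_coord A b \<rho> \<epsilon> i x))"

definition cppc_y :: "real^'n^'n \<Rightarrow> real^'n \<Rightarrow> real \<Rightarrow> real \<Rightarrow> 'n \<Rightarrow> real^'n \<Rightarrow> real^'n"
  where "cppc_y A b \<rho> \<epsilon> i x = (\<chi> j. if j = i then prox_coord A b \<rho> \<epsilon> i x else x $ j)"

definition cppc_d :: "real^'n^'n \<Rightarrow> real^'n \<Rightarrow> real \<Rightarrow> real \<Rightarrow> 'n \<Rightarrow> real^'n \<Rightarrow> real^'n"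
  where "cppc_d A b \<rho> \<epsilon> i x = x - cppc_y A b \<rho> \<epsilon> i x"

definition cppc_v :: "real^'n^'n \<Rightarrow> real^'n \<Rightarrow> real \<Rightarrow> real \<Rightarrow> 'n \<Rightarrow> real^'n \<Rightarrow> real^'n"
  where "cppc_v A b \<rho> \<epsilon> i x = \<Phi> A b (cppc_y A b \<rho> \<epsilon> i x)"

definition cppc_lambda :: "real^'n^'n \<Rightarrow> real^'n \<Rightarrow> real \<Rightarrow> real \<Rightarrow> 'n \<Rightarrow> real^'n \<Rightarrow> real"
  where "cppc_lambda A b \<rho> \<epsilon> i x =
    (cppc_v A b \<rho> \<epsilon> i x \<bullet> cppc_d A b \<rho> \<epsilon> i x) / (norm (cppc_v A b \<rho> \<epsilon> i x))\<^sup>2"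

definition cppc_step :: "real^'n^'n \<Rightarrow> real^'n \<Rightarrow> real \<Rightarrow> real \<Rightarrow> 'n \<Rightarrow> real^'n \<Rightarrow> real^'n"
  where "cppc_step A b \<rho> \<epsilon> i x = x - cppc_lambda A b \<rho> \<epsilon> i x *\<^sub>R cppc_v A b \<rho> \<epsilon> i x"

text \<open>A complete run of the method from \<open>x0\<close> with iterates \<open>x\<close> and selected indices \<open>i\<close>. The number
  \<open>N\<close> of nonterminal iterations is \<open>\<infinity>\<close> if the method never stops; if \<open>N = enat K\<close>, it stops in
  iteration \<open>K\<close> and returns \<open>x K\<close>, and the values of \<open>x\<close> beyond \<open>K\<close> are irrelevant. Since
  \<open>u / 0 = 0\<close>, a run is not cut off at an iteration with \<open>cppc_v = 0\<close>: that this never happens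
  has to be proved separately.\<close>

definition cppc_run ::
  "real^'n^'n \<Rightarrow> real^'n \<Rightarrow> real \<Rightarrow> real \<Rightarrow> real^'n \<Rightarrow> (nat \<Rightarrow> real^'n) \<Rightarrow> (nat \<Rightarrow> 'n) \<Rightarrow> enat \<Rightarrow> bool"
  where "cppc_run A b \<rho> \<epsilon> x0 x i N \<longleftrightarrow>
    x 0 = x0 \<and>
    (\<forall>k. enat k \<le> N \<longrightarrow> is_arg_max (\<lambda>j. \<bar>R A b \<rho> \<epsilon> (x k) $ j\<bar>) (\<lambda>_. True) (i k)) \<and>
    (\<forall>k. enat k < N \<longrightarrow>
       R A b \<rho> \<epsilon> (x k) $ i k \<noteq> 0 \<and> x (Suc k) = cppc_step A b \<rho> \<epsilon> (i k) (x k)) \<and>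
    (\<forall>K. N = enat K \<longrightarrow> R A b \<rho> \<epsilon> (x K) $ i K = 0)"

lemma prox_g:
  assumes "\<gamma> > 0"
  shows "is_arg_min (\<lambda>t. g t + inverse (2 * \<gamma>) * \<bar>t - z\<bar>\<^sup>2) (\<lambda>_. True) t
           \<longleftrightarrow> t = (if z \<ge> 0 then z else z / (1 + 2 * \<gamma>))"
    and "prox \<gamma> g z = (if z \<ge> 0 then z else z / (1 + 2 * \<gamma>))"
proof -
  let ?h = "\<lambda>t. g t + inverse (2 * \<gamma>) * \<bar>t - z\<bar>\<^sup>2"
  define p where "p = (if z \<ge> 0 then z else z / (1 + 2 * \<gamma>))"
  have less: "?h p < ?h t" if "t \<noteq> p" for t
  proof (cases "z \<ge> 0")
    case True
    then have "t \<noteq> z" "?h p = 0" using that by (auto simp: p_def g_def neg_part_def)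
    moreover have "inverse (2 * \<gamma>) * \<bar>t - z\<bar>\<^sup>2 > 0" "g t \<ge> 0"
      using \<open>t \<noteq> z\<close> assms by (auto simp: g_def)
    ultimately show ?thesis by linarith
  next
    case False
    then have z: "z = p * (1 + 2 * \<gamma>)" and p: "p < 0"
      using assms by (auto simp: p_def divide_neg_pos)
    have gp: "g p = p\<^sup>2" using p by (simp add: g_def neg_part_def)
    have gt: "g t \<ge> p\<^sup>2 + 2 * p * (t - p)"
    proof (cases "t \<le> 0")
      case True
      have "t\<^sup>2 - (p\<^sup>2 + 2 * p * (t - p)) = (t - p)\<^sup>2" by (simp add: power2_eq_square algebra_simps)
      then show ?thesis using True by (simp add: g_def neg_part_def) (smt (verit) zero_le_power2)
    next
      case t: False
      then have "p * t \<le> 0" using p by (simp add: mult_nonpos_nonneg)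
      moreover have "p\<^sup>2 + 2 * p * (t - p) = 2 * (p * t) - p\<^sup>2"
        by (simp add: power2_eq_square algebra_simps)
      moreover have "p\<^sup>2 \<ge> 0" by simp
      ultimately have "p\<^sup>2 + 2 * p * (t - p) \<le> 0" by linarith
      then show ?thesis using t by (simp add: g_def neg_part_def)
    qed
    have "inverse (2 * \<gamma>) * \<bar>t - z\<bar>\<^sup>2 - inverse (2 * \<gamma>) * \<bar>p - z\<bar>\<^sup>2
        = inverse (2 * \<gamma>) * ((t - z)\<^sup>2 - (p - z)\<^sup>2)"
      by (simp add: right_diff_distrib)
    also have "(t - z)\<^sup>2 - (p - z)\<^sup>2 = (t - p)\<^sup>2 - 2 * \<gamma> * (2 * p * (t - p))"
      unfolding z by algebra
    also have "inverse (2 * \<gamma>) * \<dots> = inverse (2 * \<gamma>) * (t - p)\<^sup>2 - 2 * p * (t - p)"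
    proof -
      have "inverse (2 * \<gamma>) * (u - 2 * \<gamma> * w) = inverse (2 * \<gamma>) * u - w" for u w
        using assms by (simp add: right_diff_distrib)
      then show ?thesis .
    qed
    finally have "inverse (2 * \<gamma>) * \<bar>t - z\<bar>\<^sup>2 - inverse (2 * \<gamma>) * \<bar>p - z\<bar>\<^sup>2
        = inverse (2 * \<gamma>) * (t - p)\<^sup>2 - 2 * p * (t - p)" .
    moreover have "inverse (2 * \<gamma>) * (t - p)\<^sup>2 > 0" using that assms by simp
    ultimately show ?thesis using gt gp by linarith
  qed
  show arg: "is_arg_min ?h (\<lambda>_. True) t \<longleftrightarrow> t = (if z \<ge> 0 then z else z / (1 + 2 * \<gamma>))" for t
    unfolding p_def[symmetric] is_arg_min_def by (metis less order_less_irrefl order_less_asym)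
  show "prox \<gamma> g z = (if z \<ge> 0 then z else z / (1 + 2 * \<gamma>))"
    unfolding prox_def arg_min_def arg by simp
qed

lemma cppc_run_exists: "\<exists>x i N. cppc_run A b \<rho> \<epsilon> x0 x i N"
proof -
  let ?am = "\<lambda>y. is_arg_max (\<lambda>j. \<bar>R A b \<rho> \<epsilon> y $ j\<bar>) (\<lambda>_. True)"
  define c where "c y = (SOME j. ?am y j)" for y
  have am: "?am y (c y)" for y
  proof -
    let ?f = "\<lambda>j. \<bar>R A b \<rho> \<epsilon> y $ j\<bar>"
    have "Max (range ?f) \<in> range ?f" by (rule Max_in) auto
    then obtain j where j: "Max (range ?f) = ?f j" by blast
    have "?f k \<le> ?f j" for k unfolding j[symmetric] by (rule Max_ge) auto
    then have "?am y j" by (simp add: is_arg_max_linorder)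
    then show ?thesis unfolding c_def by (rule someI)
  qed
  define x where "x k = ((\<lambda>y. cppc_step A b \<rho> \<epsilon> (c y) y) ^^ k) x0" for k
  define T where "T k \<longleftrightarrow> R A b \<rho> \<epsilon> (x k) $ c (x k) = 0" for k
  define N where "N = (if \<exists>k. T k then enat (LEAST k. T k) else \<infinity>)"
  have "cppc_run A b \<rho> \<epsilon> x0 x (\<lambda>k. c (x k)) N"
    unfolding cppc_run_def
  proof (intro conjI allI impI)
    fix k assume "enat k < N"
    then have "\<not> T k" by (auto simp: N_def split: if_splits dest: not_less_Least)
    then show "R A b \<rho> \<epsilon> (x k) $ c (x k) \<noteq> 0" by (simp add: T_def)
  next
    fix K assume "N = enat K"
    then have "T K" by (auto simp: N_def split: if_splits intro: LeastI)
    then show "R A b \<rho> \<epsilon> (x K) $ c (x K) = 0" by (simp add: T_def)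
  qed (auto simp: x_def am)
  then show ?thesis by blast
qed

end

theory Submission imports Defs begin

text \<open>Since \<open>sym A \<succeq> I\<close> and the componentwise absolute value is nonexpansive, \<open>\<Phi>\<close> is monotone.
  The prox optimality condition gives \<open>v\<^sub>i = (1 - \<gamma>\<^sub>i (a\<^sub>i\<^sub>i - 1)) R\<^sub>i\<close> at the selected
  coordinate \<open>i\<close>, hence \<open>\<langle>v, d\<rangle> \<ge> (1 - \<rho>) \<gamma>\<^sub>i R\<^sub>i\<^sup>2 > 0\<close>; so \<open>v \<noteq> 0\<close>, and by
  monotonicity the step is the projection onto a hyperplane that separates \<open>x\<close> from \<open>S\<close>. This makes
  the iterates Fejer monotone, with a gain of \<open>\<langle>v, d\<rangle>\<^sup>2 / \<parallel>v\<parallel>\<^sup>2\<close>. The greedy choice of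
  \<open>i\<close> yields \<open>\<parallel>v\<parallel> \<le> C \<bar>R\<^sub>i\<bar>\<close>, so the gain is at least a constant multiple of
  \<open>\<parallel>R\<parallel>\<^sub>\<infinity>\<^sup>2\<close>, and these squares are summable.\<close>

section \<open>Fejer monotone sequences and projection onto a hyperplane\<close>

text \<open>Fejer monotonicity keeps the sequence in a ball around one zero, so a subsequence
  converges, and by continuity its limit is itself a zero. Fejer monotonicity with respect to this
  limit then carries the whole sequence along.\<close>

lemma fejer_tendsto:
  fixes x :: "nat \<Rightarrow> 'a::euclidean_space" and f :: "'a \<Rightarrow> 'b::real_normed_vector"
  assumes cont: "continuous_on UNIV f" and fx: "(\<lambda>k. f (x k)) \<longlonglongrightarrow> 0"
    and ne: "\<exists>s. f s = 0"
    and fejer: "\<And>s k. f s = 0 \<Longrightarrow> norm (x (Suc k) - s) \<le> norm (x k - s)"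
  shows "\<exists>s. f s = 0 \<and> x \<longlonglongrightarrow> s"
proof -
  have mono: "norm (x n - s) \<le> norm (x m - s)" if "f s = 0" "m \<le> n" for s m n
    using lift_Suc_antimono_le[of "\<lambda>k. norm (x k - s)"] fejer that by blast
  obtain s0 where s0: "f s0 = 0" using ne by blast
  have "x k \<in> cball s0 (norm (x 0 - s0))" for k
    using mono[OF s0, of 0 k] by (simp add: dist_norm norm_minus_commute)
  then obtain s r where r: "strict_mono r" and lim: "(x \<circ> r) \<longlonglongrightarrow> s"
    using compact_cball[of s0 "norm (x 0 - s0)"] unfolding compact_def by meson
  have "(\<lambda>k. f ((x \<circ> r) k)) \<longlonglongrightarrow> f s"
    using continuous_on_tendsto_compose[OF cont lim] by simp
  moreover have "(\<lambda>k. f ((x \<circ> r) k)) \<longlonglongrightarrow> 0"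
    using LIMSEQ_subseq_LIMSEQ[OF fx r] by (simp add: o_def)
  ultimately have s: "f s = 0" by (rule LIMSEQ_unique)
  have "x \<longlonglongrightarrow> s"
    unfolding LIMSEQ_iff
  proof (intro allI impI)
    fix e :: real assume "e > 0"
    then obtain m where "norm ((x \<circ> r) m - s) < e" using lim unfolding LIMSEQ_iff by blast
    then show "\<exists>no. \<forall>n\<ge>no. norm (x n - s) < e"
      using mono[OF s, of "r m"] by (intro exI[of _ "r m"]) (fastforce intro: le_less_trans)
  qed
  with s show ?thesis by blast
qed

text \<open>The new point is the projection of \<open>x\<close> onto the hyperplane of all
  \<open>z\<close> with \<open>v \<bullet> (x - z) = c\<close>, and \<open>s\<close> lies on it or
  beyond it. Expanding the square gives the gain. If \<open>v = 0\<close>, both quotients are 0 and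
  the two sides agree.\<close>

lemma projection_step_norm_le:
  fixes v :: "'a::real_inner"
  assumes "0 \<le> c" and "c \<le> v \<bullet> (x - s)"
  shows "(norm (x - (c / (norm v)\<^sup>2) *\<^sub>R v - s))\<^sup>2 \<le> (norm (x - s))\<^sup>2 - c\<^sup>2 / (norm v)\<^sup>2"
proof (cases "v = 0")
  case False
  define N where "N = v \<bullet> v"
  have N: "N > 0" "(norm v)\<^sup>2 = N" using False by (auto simp: N_def power2_norm_eq_inner)
  have "(norm (x - (c / N) *\<^sub>R v - s))\<^sup>2
      = (norm (x - s))\<^sup>2 - 2 * (c / N) * (v \<bullet> (x - s)) + (c / N)\<^sup>2 * N"
  proof -
    have "(norm (u - t *\<^sub>R v))\<^sup>2 = (norm u)\<^sup>2 - 2 * t * (v \<bullet> u) + t\<^sup>2 * N" for u t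
      unfolding power2_norm_eq_inner N_def
      by (simp add: inner_diff_left inner_diff_right inner_commute power2_eq_square)
    moreover have "x - (c / N) *\<^sub>R v - s = x - s - (c / N) *\<^sub>R v" by simp
    ultimately show ?thesis by metis
  qed
  also have "(c / N)\<^sup>2 * N = c\<^sup>2 / N" using N by (simp add: power2_eq_square)
  finally have "(norm (x - (c / N) *\<^sub>R v - s))\<^sup>2
      = (norm (x - s))\<^sup>2 - 2 * (c / N) * (v \<bullet> (x - s)) + c\<^sup>2 / N" .
  moreover have "2 * (c / N) * c \<le> 2 * (c / N) * (v \<bullet> (x - s))"
    using assms N by (intro mult_left_mono) auto
  moreover have "2 * (c / N) * c = 2 * (c\<^sup>2 / N)" by (simp add: power2_eq_square)
  ultimately show ?thesis unfolding N(2) by linarith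
qed simp

section \<open>Monotonicity and Lipschitz continuity of \<Phi>\<close>

lemma abs_vec_nonexpansive: "norm (abs_vec x - abs_vec y) \<le> norm (x - y)"
  by (rule norm_le_componentwise_cart) (simp add: abs_vec_def)

text \<open>\<open>A\<close> and its transpose have the same quadratic form, so that of
  \<open>sym_part A\<close> is also that of \<open>A\<close>.\<close>

lemma inner_matrix_ge:
  fixes A :: "real^'n^'n"
  assumes "sym_part A \<succeq> mat 1"
  shows "(norm x)\<^sup>2 \<le> x \<bullet> (A *v x)"
proof -
  have "0 \<le> x \<bullet> ((sym_part A - mat 1) *v x)"
    using assms by (simp add: loewner_ge_def psd_def)
  also have "(sym_part A - mat 1) *v x = (1/2) *\<^sub>R (A *v x + transpose A *v x) - x"
    by (simp add: sym_part_def matrix_vector_mult_diff_rdistrib matrix_vector_mult_add_rdistrib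
        scaleR_matrix_vector_assoc[symmetric])
  also have "x \<bullet> \<dots> = x \<bullet> (A *v x) - x \<bullet> x"
    using dot_lmul_matrix[of x A x]
    by (simp add: inner_diff_right inner_add_right inner_commute)
  finally show ?thesis by (simp add: power2_norm_eq_inner)
qed

text \<open>By Cauchy-Schwarz the absolute value costs at most the squared distance, which is
  exactly what the linear part supplies.\<close>

lemma Phi_monotone:
  fixes A :: "real^'n^'n"
  assumes "sym_part A \<succeq> mat 1"
  shows "0 \<le> (\<Phi> A b x - \<Phi> A b y) \<bullet> (x - y)"
proof -
  have "(abs_vec x - abs_vec y) \<bullet> (x - y) \<le> norm (abs_vec x - abs_vec y) * norm (x - y)"
    by (rule norm_cauchy_schwarz)
  also have "\<dots> \<le> (norm (x - y))\<^sup>2"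
    using abs_vec_nonexpansive[of x y] by (simp add: power2_eq_square mult_right_mono)
  also have "\<dots> \<le> (x - y) \<bullet> (A *v (x - y))" by (rule inner_matrix_ge[OF assms])
  also have "\<dots> = (A *v x - A *v y) \<bullet> (x - y)"
    by (simp add: matrix_vector_mult_diff_distrib inner_commute)
  also have "\<dots> = (\<Phi> A b x - \<Phi> A b y) \<bullet> (x - y) + (abs_vec x - abs_vec y) \<bullet> (x - y)"
    by (simp add: \<Phi>_def flip: inner_add_left)
  finally show ?thesis by simp
qed

lemma Phi_lipschitz: "norm (\<Phi> A b x - \<Phi> A b y) \<le> (onorm ((*v) A) + 1) * norm (x - y)"
proof -
  have "\<Phi> A b x - \<Phi> A b y = A *v (x - y) - (abs_vec x - abs_vec y)"
    by (simp add: \<Phi>_def matrix_vector_mult_diff_distrib)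
  then have "norm (\<Phi> A b x - \<Phi> A b y) \<le> norm (A *v (x - y)) + norm (abs_vec x - abs_vec y)"
    by (simp only: norm_triangle_ineq4)
  also have "\<dots> \<le> onorm ((*v) A) * norm (x - y) + norm (x - y)"
    by (intro add_mono onorm abs_vec_nonexpansive) simp
  finally show ?thesis by (simp add: distrib_right)
qed

lemma continuous_on_Phi: "continuous_on UNIV (\<Phi> A b)"
  unfolding \<Phi>_def abs_vec_def
  by (intro continuous_intros matrix_vector_mult_linear_continuous_on)

section \<open>The proximal residual and its relation to \<Phi>\<close>

text \<open>The term \<open>t - \<bar>t\<bar>\<close> is the derivative of \<open>g\<close>.\<close>

lemma Phi_component: "\<Phi> A b x $ j = F A b x $ j + (x $ j - \<bar>x $ j\<bar>)"
  by (simp add: \<Phi>_def F_def abs_vec_def matrix_vector_mult_diff_rdistrib)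

lemma F_diff: "F A b x - F A b y = A *v (x - y) - (x - y)"
  by (simp add: F_def matrix_vector_mult_diff_rdistrib matrix_vector_mult_diff_distrib)

text \<open>Stationarity of the prox objective at its minimizer, multiplied by \<gamma>.\<close>

lemma prox_g_optimality:
  assumes "\<gamma> > 0"
  shows "\<gamma> * (prox \<gamma> g z - \<bar>prox \<gamma> g z\<bar>) = z - prox \<gamma> g z"
proof (cases "z \<ge> 0")
  case False
  define p where "p = z / (1 + 2 * \<gamma>)"
  have "z = p * (1 + 2 * \<gamma>)" "p < 0" using False assms by (auto simp: p_def divide_neg_pos)
  then show ?thesis using False by (simp add: prox_g(2)[OF assms] flip: p_def) (simp add: algebra_simps)
qed (simp add: prox_g(2)[OF assms])

context
  fixes A :: "real^'n^'n" and b :: "real^'n" and \<rho> \<epsilon> :: real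
  assumes \<rho>: "0 < \<rho>" "\<rho> < 1" and \<epsilon>: "0 < \<epsilon>"
begin

lemma stepsize_pos: "0 < stepsize A \<rho> \<epsilon> j"
  using \<rho> \<epsilon> by (simp add: stepsize_def ell_def less_max_iff_disj)

lemma stepsize_le: "stepsize A \<rho> \<epsilon> j \<le> 1 / \<epsilon>"
  using \<rho> \<epsilon> unfolding stepsize_def ell_def by (intro frac_le) auto

text \<open>Keeps the factor in \<open>cppc_v_component\<close> at least
  \<open>1 - \<rho>\<close>.\<close>

lemma stepsize_diag_le: "stepsize A \<rho> \<epsilon> j * (A $ j $ j - 1) \<le> \<rho>"
proof -
  have "ell A \<epsilon> j > 0" "A $ j $ j - 1 \<le> ell A \<epsilon> j" using \<epsilon> by (auto simp: ell_def)
  then show ?thesis using \<rho> by (simp add: stepsize_def pos_divide_le_eq mult_left_mono)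
qed

lemma prox_coord_eq: "prox_coord A b \<rho> \<epsilon> j x = x $ j - stepsize A \<rho> \<epsilon> j * R A b \<rho> \<epsilon> x $ j"
  using stepsize_pos[of j] by (simp add: R_def flip: mult.assoc)

text \<open>Prox optimality divided by the step size. The result has the form of
  \<open>Phi_component\<close>, with the derivative of \<open>g\<close> taken at the prox point
  instead of at \<open>x $ j\<close>.\<close>

lemma R_component:
  defines "p \<equiv> \<lambda>j x. prox_coord A b \<rho> \<epsilon> j x"
  shows "R A b \<rho> \<epsilon> x $ j = F A b x $ j + (p j x - \<bar>p j x\<bar>)"
proof -
  let ?\<gamma> = "stepsize A \<rho> \<epsilon> j"
  have "?\<gamma> * (p j x - \<bar>p j x\<bar>) = x $ j - ?\<gamma> * F A b x $ j - p j x"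
    unfolding p_def prox_coord_def by (rule prox_g_optimality[OF stepsize_pos])
  also have "\<dots> = ?\<gamma> * (R A b \<rho> \<epsilon> x $ j - F A b x $ j)"
    unfolding p_def prox_coord_eq by (simp add: algebra_simps)
  finally show ?thesis using stepsize_pos[of j] by simp
qed

lemma abs_Phi_component_le: "\<bar>\<Phi> A b x $ j\<bar> \<le> (1 + 2 / \<epsilon>) * \<bar>R A b \<rho> \<epsilon> x $ j\<bar>"
proof -
  let ?r = "R A b \<rho> \<epsilon> x $ j" and ?p = "prox_coord A b \<rho> \<epsilon> j x" and ?\<gamma> = "stepsize A \<rho> \<epsilon> j"
  \<comment> \<open>The map \<open>t - \<bar>t\<bar>\<close> is 2-Lipschitz.\<close>
  have "\<bar>\<Phi> A b x $ j\<bar> \<le> \<bar>?r\<bar> + 2 * \<bar>x $ j - ?p\<bar>"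
    unfolding Phi_component R_component by (smt (verit))
  also have "\<bar>x $ j - ?p\<bar> = ?\<gamma> * \<bar>?r\<bar>"
    using stepsize_pos[of j] by (simp add: prox_coord_eq abs_mult)
  also have "\<dots> \<le> 1 / \<epsilon> * \<bar>?r\<bar>" by (intro mult_right_mono stepsize_le) simp
  finally show ?thesis by (simp add: algebra_simps)
qed

section \<open>A single step of the method\<close>

lemma cppc_d_eq: "cppc_d A b \<rho> \<epsilon> i x = axis i (stepsize A \<rho> \<epsilon> i * R A b \<rho> \<epsilon> x $ i)"
  by (simp add: vec_eq_iff cppc_d_def cppc_y_def prox_coord_eq axis_def)

text \<open>Coordinate \<open>i\<close> of \<open>y\<close> is the prox point, so \<Phi> at
  \<open>y\<close> and the residual at \<open>x\<close> share the derivative of \<open>g\<close>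
  there. They differ only by the change of \<open>F\<close> along the coordinate vector
  \<open>d\<close>.\<close>

lemma cppc_v_component:
  "cppc_v A b \<rho> \<epsilon> i x $ i = (1 - stepsize A \<rho> \<epsilon> i * (A $ i $ i - 1)) * R A b \<rho> \<epsilon> x $ i"
proof -
  let ?y = "cppc_y A b \<rho> \<epsilon> i x" and ?\<gamma> = "stepsize A \<rho> \<epsilon> i" and ?r = "R A b \<rho> \<epsilon> x $ i"
  have "cppc_v A b \<rho> \<epsilon> i x $ i = F A b ?y $ i + (?r - F A b x $ i)"
    unfolding cppc_v_def Phi_component R_component by (simp add: cppc_y_def)
  also have "\<dots> = ?r - (F A b x - F A b ?y) $ i" by simp
  also have "F A b x - F A b ?y = A *v axis i (?\<gamma> * ?r) - axis i (?\<gamma> * ?r)"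
    unfolding F_diff by (simp flip: cppc_d_def add: cppc_d_eq)
  also have "\<dots> $ i = A $ i $ i * (?\<gamma> * ?r) - ?\<gamma> * ?r"
    by (simp add: matrix_vector_mult_def axis_def if_distrib[of "(*) _"] cong: if_cong)
  finally show ?thesis by (simp add: algebra_simps)
qed

lemma inner_cppc_v_d_ge:
  "(1 - \<rho>) * stepsize A \<rho> \<epsilon> i * (R A b \<rho> \<epsilon> x $ i)\<^sup>2
    \<le> cppc_v A b \<rho> \<epsilon> i x \<bullet> cppc_d A b \<rho> \<epsilon> i x"
proof -
  let ?\<gamma> = "stepsize A \<rho> \<epsilon> i" and ?r = "R A b \<rho> \<epsilon> x $ i"
  have "(1 - \<rho>) * (?\<gamma> * ?r\<^sup>2) \<le> (1 - ?\<gamma> * (A $ i $ i - 1)) * (?\<gamma> * ?r\<^sup>2)"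
    using stepsize_diag_le[of i] stepsize_pos[of i] by (intro mult_right_mono) auto
  also have "\<dots> = cppc_v A b \<rho> \<epsilon> i x \<bullet> cppc_d A b \<rho> \<epsilon> i x"
    by (simp add: cppc_d_eq inner_axis cppc_v_component power2_eq_square)
  finally show ?thesis by (simp add: mult.assoc)
qed

lemma cppc_v_nonzero:
  assumes "R A b \<rho> \<epsilon> x $ i \<noteq> 0"
  shows "cppc_v A b \<rho> \<epsilon> i x \<noteq> 0"
proof
  assume "cppc_v A b \<rho> \<epsilon> i x = 0"
  moreover have "(1 - \<rho>) * stepsize A \<rho> \<epsilon> i * (R A b \<rho> \<epsilon> x $ i)\<^sup>2 > 0"
    using assms stepsize_pos[of i] \<rho> by simp
  ultimately show False using inner_cppc_v_d_ge[of i x] by simp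
qed

text \<open>The factor \<open>CARD('n)\<close> comes from bounding the Euclidean norm by the sum of
  the coordinates. With \<open>r = 0\<close> this shows that a zero of the residual is a
  solution.\<close>

lemma norm_Phi_le:
  assumes "\<And>j. \<bar>R A b \<rho> \<epsilon> x $ j\<bar> \<le> r"
  shows "norm (\<Phi> A b x) \<le> real CARD('n) * (1 + 2 / \<epsilon>) * r"
proof -
  have "\<bar>\<Phi> A b x $ j\<bar> \<le> (1 + 2 / \<epsilon>) * r" for j
    using abs_Phi_component_le[of x j] mult_left_mono[OF assms[of j], of "1 + 2 / \<epsilon>"] \<epsilon> by simp
  then show ?thesis
    using norm_le_l1_cart[of "\<Phi> A b x"] sum_bounded_above[of UNIV "\<lambda>j. \<bar>\<Phi> A b x $ j\<bar>"]
    by (fastforce simp: mult.assoc)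
qed

text \<open>Greedy selection bounds \<Phi> at \<open>x\<close> by the selected residual; the
  Lipschitz bound transfers this to \<open>y\<close>, whose distance from \<open>x\<close> is the
  step size times that residual.\<close>

lemma norm_cppc_v_le:
  assumes "\<And>j. \<bar>R A b \<rho> \<epsilon> x $ j\<bar> \<le> \<bar>R A b \<rho> \<epsilon> x $ i\<bar>"
  shows "norm (cppc_v A b \<rho> \<epsilon> i x)
    \<le> (real CARD('n) * (1 + 2 / \<epsilon>) + (onorm ((*v) A) + 1) / \<epsilon>) * \<bar>R A b \<rho> \<epsilon> x $ i\<bar>"
proof -
  let ?r = "\<bar>R A b \<rho> \<epsilon> x $ i\<bar>" and ?y = "cppc_y A b \<rho> \<epsilon> i x" and ?L = "onorm ((*v) A) + 1"
  have L: "?L \<ge> 0" using onorm_pos_le[of "(*v) A"] by simp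
  have "norm (x - ?y) = stepsize A \<rho> \<epsilon> i * ?r"
    using stepsize_pos[of i]
    by (simp flip: cppc_d_def add: cppc_d_eq norm_eq_sqrt_inner inner_axis_axis abs_mult)
  also have "\<dots> \<le> 1 / \<epsilon> * ?r" by (intro mult_right_mono stepsize_le) simp
  finally have "norm (\<Phi> A b x - \<Phi> A b ?y) \<le> ?L * (1 / \<epsilon> * ?r)"
    using Phi_lipschitz[of A b x ?y] mult_left_mono[OF _ L] by (meson order_trans)
  moreover have "norm (\<Phi> A b ?y) \<le> norm (\<Phi> A b x) + norm (\<Phi> A b x - \<Phi> A b ?y)"
    by (metis norm_minus_commute norm_triangle_sub)
  ultimately show ?thesis
    using norm_Phi_le[OF assms] by (simp add: cppc_v_def algebra_simps add_divide_distrib)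
qed

lemma cppc_step_norm_le:
  assumes A: "sym_part A \<succeq> mat 1" and s: "\<Phi> A b s = 0"
  shows "(norm (cppc_step A b \<rho> \<epsilon> i x - s))\<^sup>2 \<le> (norm (x - s))\<^sup>2
    - (cppc_v A b \<rho> \<epsilon> i x \<bullet> cppc_d A b \<rho> \<epsilon> i x)\<^sup>2 / (norm (cppc_v A b \<rho> \<epsilon> i x))\<^sup>2"
proof -
  let ?v = "cppc_v A b \<rho> \<epsilon> i x" and ?d = "cppc_d A b \<rho> \<epsilon> i x" and ?y = "cppc_y A b \<rho> \<epsilon> i x"
  have "0 \<le> (1 - \<rho>) * stepsize A \<rho> \<epsilon> i * (R A b \<rho> \<epsilon> x $ i)\<^sup>2"
    using stepsize_pos[of i] \<rho> by simp
  then have "0 \<le> ?v \<bullet> ?d" using inner_cppc_v_d_ge[of i x] by linarith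
  \<comment> \<open>Monotonicity between \<open>y\<close> and the zero \<open>s\<close>: the
    hyperplane through \<open>y\<close> with normal \<open>v\<close> separates \<open>x\<close> from
    \<open>s\<close>.\<close>
  moreover have "0 \<le> ?v \<bullet> (?y - s)"
    using Phi_monotone[OF A, of b ?y s] s by (simp add: cppc_v_def)
  then have "?v \<bullet> ?d \<le> ?v \<bullet> (x - s)" by (simp add: cppc_d_def inner_diff_right)
  ultimately show ?thesis
    unfolding cppc_step_def cppc_lambda_def by (rule projection_step_norm_le)
qed

text \<open>One constant serves all points, indices and solutions, because the step sizes of the
  finitely many coordinates have a positive minimum.\<close>

lemma cppc_step_decrease:
  assumes A: "sym_part A \<succeq> mat 1"
  obtains c where "c > 0"
    and "\<And>s x i. \<Phi> A b s = 0 \<Longrightarrow> (\<And>j. \<bar>R A b \<rho> \<epsilon> x $ j\<bar> \<le> \<bar>R A b \<rho> \<epsilon> x $ i\<bar>) \<Longrightarrow>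
      (norm (cppc_step A b \<rho> \<epsilon> i x - s))\<^sup>2 \<le> (norm (x - s))\<^sup>2 - c * (R A b \<rho> \<epsilon> x $ i)\<^sup>2"
proof
  define C where "C = real CARD('n) * (1 + 2 / \<epsilon>) + (onorm ((*v) A) + 1) / \<epsilon>"
  define m where "m = (1 - \<rho>) * Min (range (stepsize A \<rho> \<epsilon>))"
  have m: "m > 0" using \<rho> stepsize_pos by (simp add: m_def)
  have "C > 0"
    using onorm_pos_le[of "(*v) A"] \<epsilon> unfolding C_def
    by (intro add_pos_nonneg mult_pos_pos divide_nonneg_pos) (auto intro: add_pos_pos)
  with m show "(m / C)\<^sup>2 > 0" by simp
  fix s x i
  assume s: "\<Phi> A b s = 0" and max: "\<And>j. \<bar>R A b \<rho> \<epsilon> x $ j\<bar> \<le> \<bar>R A b \<rho> \<epsilon> x $ i\<bar>"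
  let ?v = "cppc_v A b \<rho> \<epsilon> i x" and ?d = "cppc_d A b \<rho> \<epsilon> i x" and ?r = "R A b \<rho> \<epsilon> x $ i"
  have "(m / C)\<^sup>2 * ?r\<^sup>2 \<le> (?v \<bullet> ?d)\<^sup>2 / (norm ?v)\<^sup>2"
  proof (cases "?r = 0")
    case False
    then have v: "norm ?v > 0" using cppc_v_nonzero by simp
    have "m \<le> (1 - \<rho>) * stepsize A \<rho> \<epsilon> i" using \<rho> by (simp add: m_def)
    then have "m * ?r\<^sup>2 \<le> (1 - \<rho>) * stepsize A \<rho> \<epsilon> i * ?r\<^sup>2" by (rule mult_right_mono) simp
    also have "\<dots> \<le> ?v \<bullet> ?d" by (rule inner_cppc_v_d_ge)
    finally have vd: "m * ?r\<^sup>2 \<le> ?v \<bullet> ?d" .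
    \<comment> \<open>Written as a quotient so that numerator and denominator can be compared
      separately with \<open>v \<bullet> d\<close> and the norm of \<open>v\<close>.\<close>
    have "m / C * \<bar>?r\<bar> = m * ?r\<^sup>2 / (C * \<bar>?r\<bar>)"
      using False by (cases "?r > 0") (simp_all add: power2_eq_square)
    also have "\<dots> \<le> (?v \<bullet> ?d) / norm ?v"
      using vd v norm_cppc_v_le[OF max] m order_trans[OF _ vd]
      by (intro frac_le) (auto simp: C_def)
    finally have "(m / C * \<bar>?r\<bar>)\<^sup>2 \<le> ((?v \<bullet> ?d) / norm ?v)\<^sup>2"
      using m \<open>C > 0\<close> by (intro power_mono) auto
    then show ?thesis by (simp add: power_mult_distrib power_divide)
  qed simp
  then show "(norm (cppc_step A b \<rho> \<epsilon> i x - s))\<^sup>2 \<le> (norm (x - s))\<^sup>2 - (m / C)\<^sup>2 * ?r\<^sup>2"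
    using cppc_step_norm_le[OF A s, of i x] by linarith
qed

end

section \<open>Termination and convergence of runs\<close>

lemma infnorm_eq_arg_max:
  fixes u :: "real^'n"
  assumes "is_arg_max (\<lambda>j. \<bar>u $ j\<bar>) (\<lambda>_. True) i"
  shows "infnorm u = \<bar>u $ i\<bar>"
proof -
  have "\<bar>u $ j\<bar> \<le> \<bar>u $ i\<bar>" for j using assms by (simp add: is_arg_max_linorder)
  then show ?thesis unfolding infnorm_cart by (intro cSup_eq_maximum) auto
qed

theorem theorem4p3:
  fixes A :: "real^'n^'n" and b x0 :: "real^'n" and \<rho> \<epsilon> :: real
  assumes "sym_part A \<succeq> mat 1"
    and "solutions A b \<noteq> {}"
    and "0 < \<rho>" and "\<rho> < 1" and "0 < \<epsilon>"
  shows "\<forall>x i N. cppc_run A b \<rho> \<epsilon> x0 x i N \<longrightarrow>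
    (\<forall>k. enat k < N \<longrightarrow> cppc_v A b \<rho> \<epsilon> (i k) (x k) \<noteq> 0) \<and>
    (\<forall>K. N = enat K \<longrightarrow> x K \<in> solutions A b) \<and>
    (N = \<infinity> \<longrightarrow>
       (\<exists>xstar \<in> solutions A b. x \<longlonglongrightarrow> xstar) \<and>
       summable (\<lambda>k. (infnorm (R A b \<rho> \<epsilon> (x k)))\<^sup>2) \<and>
       (\<lambda>k. R A b \<rho> \<epsilon> (x k)) \<longlonglongrightarrow> 0 \<and>
       (\<lambda>k. \<Phi> A b (x k)) \<longlonglongrightarrow> 0)"
proof (intro allI impI)
  fix x i N
  assume run: "cppc_run A b \<rho> \<epsilon> x0 x i N"
  let ?R = "\<lambda>k. R A b \<rho> \<epsilon> (x k)"
  note params = assms(3-5)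
  have am: "is_arg_max (\<lambda>j. \<bar>?R k $ j\<bar>) (\<lambda>_. True) (i k)" if "enat k \<le> N" for k
    using run that by (simp add: cppc_run_def)
  have le: "\<bar>?R k $ j\<bar> \<le> \<bar>?R k $ i k\<bar>" if "enat k \<le> N" for j k
    using am[OF that] by (simp add: is_arg_max_linorder)
  have step: "?R k $ i k \<noteq> 0" "x (Suc k) = cppc_step A b \<rho> \<epsilon> (i k) (x k)" if "enat k < N" for k
    using run that by (auto simp: cppc_run_def)
  have "x K \<in> solutions A b" if N: "N = enat K" for K
  proof -
    have "?R K $ i K = 0" using run N by (simp add: cppc_run_def)
    \<comment> \<open>The largest residual vanishes, hence all do.\<close>
    then have "\<bar>?R K $ j\<bar> \<le> 0" for j using le[of K j] N by simp
    from norm_Phi_le[OF params this] show ?thesis by (simp add: solutions_def)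
  qed
  moreover have "(\<exists>xstar \<in> solutions A b. x \<longlonglongrightarrow> xstar) \<and>
      summable (\<lambda>k. (infnorm (?R k))\<^sup>2) \<and> ?R \<longlonglongrightarrow> 0 \<and> (\<lambda>k. \<Phi> A b (x k)) \<longlonglongrightarrow> 0"
    if N: "N = \<infinity>"
  proof -
    obtain c where c: "c > 0" and dec: "\<And>s k. \<Phi> A b s = 0 \<Longrightarrow>
        (norm (x (Suc k) - s))\<^sup>2 \<le> (norm (x k - s))\<^sup>2 - c * (?R k $ i k)\<^sup>2"
    proof (rule cppc_step_decrease[OF params assms(1)])
      fix c :: real
      assume "c > 0" and "\<And>s x i. \<Phi> A b s = 0 \<Longrightarrow>
        (\<And>j. \<bar>R A b \<rho> \<epsilon> x $ j\<bar> \<le> \<bar>R A b \<rho> \<epsilon> x $ i\<bar>) \<Longrightarrow>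
        (norm (cppc_step A b \<rho> \<epsilon> i x - s))\<^sup>2 \<le> (norm (x - s))\<^sup>2 - c * (R A b \<rho> \<epsilon> x $ i)\<^sup>2"
      then show thesis using that[of c] step(2) le N by simp
    qed
    obtain s where s: "\<Phi> A b s = 0" using assms(2) by (auto simp: solutions_def)
    have inf: "infnorm (?R k) = \<bar>?R k $ i k\<bar>" for k using infnorm_eq_arg_max[OF am] N by simp
    \<comment> \<open>The decreases telescope, which bounds the partial sums uniformly.\<close>
    have "c * (\<Sum>k<n. (infnorm (?R k))\<^sup>2) \<le> (norm (x 0 - s))\<^sup>2 - (norm (x n - s))\<^sup>2" for n
    proof (induction n)
      case (Suc n)
      then show ?case using dec[OF s, of n] by (simp add: inf distrib_left)
    qed simp
    then have "(\<Sum>k<n. (infnorm (?R k))\<^sup>2) \<le> (norm (x 0 - s))\<^sup>2 / c" for n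
      using c by (simp add: pos_le_divide_eq mult.commute) (smt (verit) zero_le_power2)
    then have sum: "summable (\<lambda>k. (infnorm (?R k))\<^sup>2)"
      by (intro summableI_nonneg_bounded) auto
    then have "(\<lambda>k. (infnorm (?R k))\<^sup>2) \<longlonglongrightarrow> 0" by (rule summable_LIMSEQ_zero)
    then have R0: "(\<lambda>k. \<bar>?R k $ i k\<bar>) \<longlonglongrightarrow> 0"
      using tendsto_real_sqrt by (fastforce simp: inf)
    have "?R \<longlonglongrightarrow> 0"
    proof (rule vec_tendstoI)
      show "(\<lambda>k. ?R k $ j) \<longlonglongrightarrow> 0 $ j" for j
        using Lim_null_comparison[OF _ R0, of "\<lambda>k. ?R k $ j"] le N by simp
    qed
    moreover have Phi0: "(\<lambda>k. \<Phi> A b (x k)) \<longlonglongrightarrow> 0"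
    proof (rule Lim_null_comparison)
      let ?C = "real CARD('n) * (1 + 2 / \<epsilon>)"
      show "\<forall>\<^sub>F k in sequentially. norm (\<Phi> A b (x k)) \<le> ?C * \<bar>?R k $ i k\<bar>"
        using norm_Phi_le[OF params le] N by simp
      show "(\<lambda>k. ?C * \<bar>?R k $ i k\<bar>) \<longlonglongrightarrow> 0"
        using tendsto_mult_right_zero[OF R0] by simp
    qed
    \<comment> \<open>Needed for every solution, since the limit is not known in advance.\<close>
    moreover have "norm (x (Suc k) - s) \<le> norm (x k - s)" if "\<Phi> A b s = 0" for s k
    proof (rule power2_le_imp_le)
      have "0 \<le> c * (?R k $ i k)\<^sup>2" using c by simp
      with dec[OF that, of k] show "(norm (x (Suc k) - s))\<^sup>2 \<le> (norm (x k - s))\<^sup>2" by linarith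
    qed simp
    then have "\<exists>s. \<Phi> A b s = 0 \<and> x \<longlonglongrightarrow> s"
      using fejer_tendsto[OF continuous_on_Phi Phi0] s by blast
    ultimately show ?thesis using sum by (auto simp: solutions_def)
  qed
  ultimately show "(\<forall>k. enat k < N \<longrightarrow> cppc_v A b \<rho> \<epsilon> (i k) (x k) \<noteq> 0) \<and>
    (\<forall>K. N = enat K \<longrightarrow> x K \<in> solutions A b) \<and>
    (N = \<infinity> \<longrightarrow>
       (\<exists>xstar \<in> solutions A b. x \<longlonglongrightarrow> xstar) \<and>
       summable (\<lambda>k. (infnorm (?R k))\<^sup>2) \<and> ?R \<longlonglongrightarrow> 0 \<and> (\<lambda>k. \<Phi> A b (x k)) \<longlonglongrightarrow> 0)"
    using cppc_v_nonzero[OF params step(1)] by blast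
qed

end
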